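(* Let $(\mathcal{H},d)$ be a Hadamard space and let $h:\mathcal{H}\to\mathbb{R}$ be convex such that $h=\sum_{k=1}^Nh_k$, where each $h_k:\mathcal{H}\to\mathbb{R}$ is convex and $L_k$-Lipschitz. Let $S_t(x)$ be the gradient flow semigroup associated with $h$. Then for every $t\ge0$, every $x\in\mathcal{H}$ and every integer $n\ge1$: \[ d\left(S_t(x),\left(\mathrm{prox}_{\frac tn h_N}\circ\dots\circ\mathrm{prox}_{\frac tn h_1}\right)^{(n)}(x)\right)\le 8Lt\,n^{-1/4}, \] where $L:=\sum_{k=1}^NL_k$.
   Context: A Hadamard space is a complete metric space $(\mathcal{H},d)$ in which any two points are joined by a geodesic (an isometric embedding $\gamma:[0,l]\to\mathcal{H}$) and such that $d^2(\gamma(tl),x)\le(1-t)d^2(\gamma(0),x)+td^2(\gamma(l),x)-t(1-t)d^2(\gamma(0),\gamma(l))$ for all $x\in\mathcal{H}$, $t\in[0,1]$ and all geodesics $\gamma:[0,l]\to\mathcal{H}$. Convexity of functions on $\mathcal{H}$ means convexity along geodesics. For $g:\mathcal{H}\to\mathbb{R}$ convex and lower-semicontinuous and $\lambda>0$, $\mathrm{prox}_{\lambda g}(x)=\mathrm{argmin}_{y\in\mathcal{H}}\{g(y)+\frac1{2\lambda}d^2(x,y)\}$ (a single point), and $\mathrm{prox}_{0\cdot g}$ is the identity. The gradient flow semigroup associated with $g$ is $S_t(x)=\lim_{k\to\infty}(\mathrm{prox}_{\frac tk g})^{(k)}(x)$ for $t>0$ and $S_0(x)=x$. $Q^{(n)}$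 denotes the $n$-fold iterate of a map $Q$. *)

theory Defs
  imports "HOL-Analysis.Analysis"
begin

definition geodesic :: "real \<Rightarrow> (real \<Rightarrow> 'a::metric_space) \<Rightarrow> bool" where
  "geodesic l \<gamma> \<longleftrightarrow> 0 \<le> l \<and> (\<forall>s\<in>{0..l}. \<forall>t\<in>{0..l}. dist (\<gamma> s) (\<gamma> t) = \<bar>s - t\<bar>)"

class hadamard_space = complete_space +
  assumes geodesic_joining: "\<exists>l \<gamma>. geodesic l \<gamma> \<and> \<gamma> 0 = p \<and> \<gamma> l = q"
    and geodesic_CAT0: "geodesic l \<gamma> \<Longrightarrow> 0 \<le> t \<Longrightarrow> t \<le> 1 \<Longrightarrow>
      (dist (\<gamma> (t * l)) x)\<^sup>2 \<le>
        (1 - t) * (dist (\<gamma> 0) x)\<^sup>2 + t * (dist (\<gamma> l) x)\<^sup>2 - t * (1 - t) * (dist (\<gamma> 0) (\<gamma> l))\<^sup>2"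

definition geodesically_convex :: "('a::metric_space \<Rightarrow> real) \<Rightarrow> bool" where
  "geodesically_convex f \<longleftrightarrow> (\<forall>l \<gamma>. geodesic l \<gamma> \<longrightarrow> convex_on {0..l} (\<lambda>s. f (\<gamma> s)))"

text \<open>The value is meaningful for \<open>c \<ge> 0\<close> and \<open>g\<close> convex and lower semicontinuous on a
  Hadamard space: the minimiser selected by \<^const>\<open>arg_min\<close> then exists and is unique.\<close>

definition prox :: "real \<Rightarrow> ('a::metric_space \<Rightarrow> real) \<Rightarrow> 'a \<Rightarrow> 'a" where
  "prox c g x = (if c = 0 then x else (ARG_MIN (\<lambda>y. g y + 1 / (2 * c) * (dist x y)\<^sup>2) y. True))"

text \<open>The term with index \<open>k = 0\<close> of the sequence is \<open>x\<close>; it does not affect the limit.\<close>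

definition gradient_flow :: "('a::metric_space \<Rightarrow> real) \<Rightarrow> real \<Rightarrow> 'a \<Rightarrow> 'a" where
  "gradient_flow g t x = (if t = 0 then x else lim (\<lambda>k. (prox (t / real k) g ^^ k) x))"

text \<open>\<open>cyclic_prox c h N\<close> is \<open>prox c (h N) \<circ> \<dots> \<circ> prox c (h 1)\<close>: \<^const>\<open>fold\<close> applies
  the function belonging to the first list element first.\<close>

definition cyclic_prox :: "real \<Rightarrow> (nat \<Rightarrow> 'a::metric_space \<Rightarrow> real) \<Rightarrow> nat \<Rightarrow> 'a \<Rightarrow> 'a" where
  "cyclic_prox c h N = fold (\<lambda>k. prox c (h k)) [1..<Suc N]"

end

theory Submission
  imports Defs
begin

text \<open>A proximal step satisfies the evolution variational inequality
  \<open>d(x', y)\<^sup>2 \<le> d(x, y)\<^sup>2 + 2c (g y - g x')\<close>. Summing it over one cycle, and using that the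
  cycle moves points by at most \<open>c L\<close>, gives the same inequality for \<open>h\<close> with an additional error
  \<open>c\<^sup>2 L\<^sup>2\<close>. Two such schemes \<open>X\<close>, \<open>Z\<close> with steps \<open>c\<close>, \<open>s\<close> can be tested against each other: in the
  combination with weights \<open>s\<close> and \<open>c\<close> the values of \<open>h\<close> cancel, which leaves a Kobayashi type
  recursion for \<open>d(X i, Z j)\<^sup>2\<close>. For \<open>c = t / n\<close>, \<open>s = t / m\<close> it yields
  \<open>d(X n, Z m) \<le> L t sqrt (2 / n + 2 / m)\<close>. Applied to two resolvent schemes of \<open>h\<close> this shows
  that the limit defining the gradient flow exists; applied to the cyclic scheme and the resolvent
  scheme, as \<open>m\<close> tends to infinity, it gives the stronger rate \<open>L t sqrt (2 / n)\<close>.\<close>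

section \<open>The proximal objective and its minimiser\<close>

definition prox_objective :: "real \<Rightarrow> ('a::metric_space \<Rightarrow> real) \<Rightarrow> 'a \<Rightarrow> 'a \<Rightarrow> real" where
  "prox_objective c g x y = g y + 1 / (2 * c) * (dist x y)\<^sup>2"

text \<open>On a geodesic from \<open>p\<close> to \<open>q\<close>, convexity of \<open>g\<close>
  is added to 1/(2c) times the CAT(0) inequality; \<open>m\<close> is the point at fraction
  \<open>\<theta>\<close>.\<close>

lemma prox_objective_strongly_convex:
  fixes g :: "'a::hadamard_space \<Rightarrow> real"
  assumes g: "geodesically_convex g" and c: "0 < c" and \<theta>: "0 \<le> \<theta>" "\<theta> \<le> 1"
  obtains m where "prox_objective c g x m \<le> (1 - \<theta>) * prox_objective c g x p
    + \<theta> * prox_objective c g x q - \<theta> * (1 - \<theta>) / (2 * c) * (dist p q)\<^sup>2"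
proof -
  obtain l \<gamma> where \<gamma>: "geodesic l \<gamma>" "\<gamma> 0 = p" "\<gamma> l = q"
    using geodesic_joining by blast
  let ?m = "\<gamma> (\<theta> * l)"
  have l: "0 \<le> l" using \<gamma>(1) by (simp add: geodesic_def)
  have "convex_on {0..l} (\<lambda>s. g (\<gamma> s))"
    using g \<gamma>(1) by (simp add: geodesically_convex_def)
  from convex_onD[OF this \<theta>, of 0 l] have gm: "g ?m \<le> (1 - \<theta>) * g p + \<theta> * g q"
    using l \<gamma> by simp
  have "(dist x ?m)\<^sup>2 \<le> (1 - \<theta>) * (dist x p)\<^sup>2 + \<theta> * (dist x q)\<^sup>2 - \<theta> * (1 - \<theta>) * (dist p q)\<^sup>2"
    using geodesic_CAT0[OF \<gamma>(1) \<theta>, of x] \<gamma> by (simp add: dist_commute)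
  then have "1 / (2 * c) * (dist x ?m)\<^sup>2 \<le> 1 / (2 * c) *
      ((1 - \<theta>) * (dist x p)\<^sup>2 + \<theta> * (dist x q)\<^sup>2 - \<theta> * (1 - \<theta>) * (dist p q)\<^sup>2)"
    using c by (intro mult_left_mono) auto
  with gm have "prox_objective c g x ?m \<le> (1 - \<theta>) * prox_objective c g x p
    + \<theta> * prox_objective c g x q - \<theta> * (1 - \<theta>) / (2 * c) * (dist p q)\<^sup>2"
    by (simp add: prox_objective_def algebra_simps diff_divide_distrib add_divide_distrib)
  then show thesis by (rule that)
qed

lemma prox_objective_bdd_below:
  fixes g :: "'a::metric_space \<Rightarrow> real"
  assumes "L-lipschitz_on UNIV g" and c: "0 < c"
  shows "g x - c * L\<^sup>2 / 2 \<le> prox_objective c g x y"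
proof -
  have "g x - g y \<le> L * dist x y"
    using lipschitz_onD[OF assms(1), of x y] by (simp add: dist_real_def)
  \<comment> \<open>Completing the square: the linear loss \<open>L * dist x y\<close> is absorbed
    by the quadratic penalty at the cost of \<open>c * L^2 / 2\<close>.\<close>
  moreover have "0 \<le> (dist x y - c * L)\<^sup>2 / (2 * c)"
    using c by simp
  moreover have "(dist x y - c * L)\<^sup>2 / (2 * c)
      = 1 / (2 * c) * (dist x y)\<^sup>2 - L * dist x y + c * L\<^sup>2 / 2"
    using c by (simp add: field_simps power2_eq_square)
  ultimately show ?thesis
    by (simp add: prox_objective_def)
qed

text \<open>Completeness takes the place of compactness: strong convexity forces every minimising
  sequence to be Cauchy.\<close>

lemma prox_objective_has_minimum:
  fixes g :: "'a::hadamard_space \<Rightarrow> real"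
  assumes g: "geodesically_convex g" and lip: "L-lipschitz_on UNIV g" and c: "0 < c"
  obtains z where "\<And>y. prox_objective c g x z \<le> prox_objective c g x y"
proof -
  let ?F = "prox_objective c g x"
  define I where "I = Inf (range ?F)"
  have bdd: "bdd_below (range ?F)"
    using prox_objective_bdd_below[OF lip c] by (intro bdd_belowI) auto
  have I_le: "I \<le> ?F y" for y
    unfolding I_def using bdd by (simp add: cInf_lower)
  have "\<exists>p. ?F p < I + 1 / real (Suc k)" for k
    using cInf_lessD[of "range ?F" "I + 1 / real (Suc k)"] by (auto simp: I_def)
  then obtain p where p: "\<And>k. ?F (p k) < I + 1 / real (Suc k)"
    by metis
  \<comment> \<open>At \<open>\<theta> = 1/2\<close> the value at \<open>m\<close> is at least the
    infimum \<open>I\<close>, so near-minimisers lie close together.\<close>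
  have midpoint: "(dist u v)\<^sup>2 \<le> 4 * c * ((?F u - I) + (?F v - I))" for u v
  proof -
    obtain m where "?F m \<le> (1 - 1/2) * ?F u + 1/2 * ?F v - 1/2 * (1 - 1/2) / (2 * c) * (dist u v)\<^sup>2"
      using prox_objective_strongly_convex[OF g c, of "1/2" x u v] by auto
    with I_le[of m] have "(dist u v)\<^sup>2 / (8 * c) \<le> ((?F u - I) + (?F v - I)) / 2"
      by (simp add: field_simps)
    then show ?thesis using c by (simp add: field_simps)
  qed
  have "Cauchy p"
  proof (rule metric_CauchyI)
    fix e :: real assume e: "0 < e"
    \<comment> \<open>Both excesses are at most 1/M, so \<open>midpoint\<close> bounds the squared
      distance by 8c/M.\<close>
    then obtain M where M: "8 * c / e\<^sup>2 < real M"
      using reals_Archimedean2 by blast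
    have "dist (p i) (p j) < e" if "M \<le> i" "M \<le> j" for i j
    proof -
      have M0: "0 < real M" using M c e by (smt (verit) divide_pos_pos zero_less_power)
      have "1 / real (Suc k) \<le> 1 / real M" if "M \<le> k" for k
        using M0 that by (intro divide_left_mono) auto
      with p that have "?F (p i) - I \<le> 1 / real M" "?F (p j) - I \<le> 1 / real M"
        by (smt (verit))+
      then have "(dist (p i) (p j))\<^sup>2 \<le> 4 * c * (1 / real M + 1 / real M)"
        using midpoint[of "p i" "p j"] c
        by (smt (verit) mult_left_mono)
      also have "\<dots> < e\<^sup>2"
        using M M0 e by (simp add: field_simps)
      finally show ?thesis using e by (simp add: power2_less_imp_less)
    qed
    then show "\<exists>M. \<forall>m\<ge>M. \<forall>n\<ge>M. dist (p m) (p n) < e" by blast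
  qed
  then obtain z where z: "p \<longlonglongrightarrow> z"
    using Cauchy_convergent convergent_def by blast
  have "isCont g z"
    using lipschitz_on_continuous_on[OF lip] by (simp add: continuous_on_eq_continuous_at)
  then have "(\<lambda>k. ?F (p k)) \<longlonglongrightarrow> ?F z"
    unfolding prox_objective_def by (intro tendsto_intros z isCont_tendsto_compose[OF _ z])
  moreover have "(\<lambda>k. I + 1 / real (Suc k)) \<longlonglongrightarrow> I + 0"
    by (intro tendsto_intros LIMSEQ_Suc lim_1_over_n)
  ultimately have "?F z \<le> I + 0"
    by (rule LIMSEQ_le) (use p in \<open>auto intro: less_imp_le\<close>)
  then have "?F z \<le> ?F y" for y
    using I_le[of y] by simp
  then show thesis by (rule that)
qed

text \<open>\<open>prox\<close> selects by choice, so \<open>arg_min\<close> has the minimising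
  property only once some minimiser is known to exist.\<close>

lemma prox_minimizes:
  fixes g :: "'a::hadamard_space \<Rightarrow> real"
  assumes "geodesically_convex g" "L-lipschitz_on UNIV g" and c: "0 < c"
  shows "prox_objective c g x (prox c g x) \<le> prox_objective c g x y"
proof -
  obtain z where z: "\<And>y. prox_objective c g x z \<le> prox_objective c g x y"
    using prox_objective_has_minimum[OF assms] by blast
  have "prox c g x = arg_min (prox_objective c g x) (\<lambda>_. True)"
    using c by (simp add: prox_def prox_objective_def[abs_def])
  moreover have "\<forall>y. \<not> prox_objective c g x y
      < prox_objective c g x (arg_min (prox_objective c g x) (\<lambda>_. True))"
    by (rule arg_minI[where x = z]) (use z in \<open>auto simp: not_less\<close>)
  ultimately show ?thesis by (simp add: not_less)
qed

section \<open>Estimates for a single proximal step\<close>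

text \<open>The minimiser is compared with points slightly displaced towards \<open>y\<close>;
  dividing by the displacement \<open>\<theta>\<close> and letting it tend to 0 leaves the full
  quadratic gain 1/(2c).\<close>

lemma prox_variational_inequality:
  fixes g :: "'a::hadamard_space \<Rightarrow> real"
  assumes g: "geodesically_convex g" and lip: "L-lipschitz_on UNIV g" and "0 \<le> c"
  shows "(dist (prox c g x) y)\<^sup>2
    \<le> (dist x y)\<^sup>2 - (dist x (prox c g x))\<^sup>2 + 2 * c * (g y - g (prox c g x))"
proof (cases "c = 0")
  case True
  then show ?thesis by (simp add: prox_def)
next
  case False
  with \<open>0 \<le> c\<close> have c: "0 < c" by simp
  let ?F = "prox_objective c g x" and ?z = "prox c g x"
  have bound: "?F ?z \<le> ?F y - (1 - \<theta>) / (2 * c) * (dist ?z y)\<^sup>2" if \<theta>: "0 < \<theta>" "\<theta> \<le> 1" for \<theta>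
  proof -
    obtain m where m: "?F m \<le> (1 - \<theta>) * ?F ?z + \<theta> * ?F y - \<theta> * (1 - \<theta>) / (2 * c) * (dist ?z y)\<^sup>2"
      using prox_objective_strongly_convex[OF g c, of \<theta> x ?z y] \<theta> by auto
    have "?F ?z \<le> ?F m" by (rule prox_minimizes[OF g lip c])
    with m have "\<theta> * ?F ?z \<le> \<theta> * (?F y - (1 - \<theta>) / (2 * c) * (dist ?z y)\<^sup>2)"
      by (simp add: algebra_simps)
    then show ?thesis using \<theta> by simp
  qed
  have "((\<lambda>\<theta>. ?F y - (1 - \<theta>) / (2 * c) * (dist ?z y)\<^sup>2) \<longlongrightarrow>
      ?F y - (1 - 0) / (2 * c) * (dist ?z y)\<^sup>2) (at_right 0)"
    using c by (intro tendsto_intros) auto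
  moreover have "eventually (\<lambda>\<theta>. ?F ?z \<le> ?F y - (1 - \<theta>) / (2 * c) * (dist ?z y)\<^sup>2) (at_right 0)"
    using eventually_at_right_less[of "0::real"] eventually_at_right_real[of 0 1, simplified]
    by eventually_elim (use bound in auto)
  ultimately have "?F ?z \<le> ?F y - (1 - 0) / (2 * c) * (dist ?z y)\<^sup>2"
    by (rule tendsto_lowerbound) simp
  then have "2 * c * ?F ?z \<le> 2 * c * (?F y - 1 / (2 * c) * (dist ?z y)\<^sup>2)"
    using c by (intro mult_left_mono) auto
  then show ?thesis
    using c by (simp add: prox_objective_def distrib_left right_diff_distrib)
qed

text \<open>Testing with \<open>y = x\<close> puts the squared step length on both sides; together
  they cancel the factor 2 in \<open>2 * c\<close>, which gives the constant
  \<open>c * L\<close>.\<close>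

lemma dist_prox_le:
  fixes g :: "'a::hadamard_space \<Rightarrow> real"
  assumes g: "geodesically_convex g" and lip: "L-lipschitz_on UNIV g" and c: "0 \<le> c"
  shows "dist x (prox c g x) \<le> c * L"
proof -
  let ?d = "dist x (prox c g x)"
  have "g x - g (prox c g x) \<le> L * ?d"
    using lipschitz_onD[OF lip, of x "prox c g x"] by (simp add: dist_real_def)
  then have "2 * c * (g x - g (prox c g x)) \<le> 2 * c * (L * ?d)"
    using c by (intro mult_left_mono) auto
  then have "?d * ?d \<le> (c * L) * ?d"
    using prox_variational_inequality[OF assms, of x x]
    by (simp add: dist_commute power2_eq_square)
  then show ?thesis
    using c lipschitz_on_nonneg[OF lip] by (cases "?d = 0") (auto simp: mult_le_cancel_right)
qed

section \<open>Estimates for a full cycle\<close>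

lemma cyclic_prox_0 [simp]: "cyclic_prox c hs 0 x = x"
  by (simp add: cyclic_prox_def)

lemma cyclic_prox_Suc:
  "cyclic_prox c hs (Suc N) x = prox c (hs (Suc N)) (cyclic_prox c hs N x)"
  by (simp add: cyclic_prox_def)

lemma cyclic_prox_zero_step [simp]: "cyclic_prox 0 hs N x = x"
  by (induction N) (simp_all add: cyclic_prox_Suc prox_def)

lemma lipschitz_on_sum:
  fixes f :: "'i \<Rightarrow> 'a::metric_space \<Rightarrow> 'b::real_normed_vector"
  assumes "\<And>i. i \<in> I \<Longrightarrow> (L i)-lipschitz_on U (f i)"
  shows "(\<Sum>i\<in>I. L i)-lipschitz_on U (\<lambda>x. \<Sum>i\<in>I. f i x)"
  using assms
proof (induction I rule: infinite_finite_induct)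
  case (insert i I)
  then show ?case by (simp add: lipschitz_on_add)
qed (simp_all add: lipschitz_on_constant)

lemma dist_cyclic_prox_le:
  fixes hs :: "nat \<Rightarrow> 'a::hadamard_space \<Rightarrow> real"
  assumes "\<And>k. k \<in> {1..N} \<Longrightarrow> geodesically_convex (hs k)"
    and "\<And>k. k \<in> {1..N} \<Longrightarrow> (Ls k)-lipschitz_on UNIV (hs k)" and "0 \<le> c"
  shows "dist x (cyclic_prox c hs N x) \<le> c * (\<Sum>k=1..N. Ls k)"
  using assms(1,2)
proof (induction N)
  case (Suc N)
  let ?w = "cyclic_prox c hs N x"
  have "dist x ?w \<le> c * (\<Sum>k=1..N. Ls k)"
    using Suc by simp
  moreover have "dist ?w (prox c (hs (Suc N)) ?w) \<le> c * Ls (Suc N)"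
    using Suc.prems \<open>0 \<le> c\<close> by (intro dist_prox_le) auto
  ultimately show ?case
    using dist_triangle[of x "prox c (hs (Suc N)) ?w" ?w]
    by (simp add: cyclic_prox_Suc algebra_simps)
qed simp

text \<open>The induction hypothesis evaluates the earlier summands at \<open>w\<close>, before the
  last step. Moving them to the endpoint \<open>v\<close> costs their Lipschitz constant times the
  step length, which is paid for by the cross term of the squared sum.\<close>

lemma cyclic_prox_variational_inequality:
  fixes hs :: "nat \<Rightarrow> 'a::hadamard_space \<Rightarrow> real"
  assumes "\<And>k. k \<in> {1..N} \<Longrightarrow> geodesically_convex (hs k)"
    and "\<And>k. k \<in> {1..N} \<Longrightarrow> (Ls k)-lipschitz_on UNIV (hs k)" and c: "0 \<le> c"
  shows "(dist (cyclic_prox c hs N x) y)\<^sup>2 \<le> (dist x y)\<^sup>2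
    + 2 * c * ((\<Sum>k=1..N. hs k y) - (\<Sum>k=1..N. hs k (cyclic_prox c hs N x)))
    + c\<^sup>2 * (\<Sum>k=1..N. Ls k)\<^sup>2"
  using assms(1,2)
proof (induction N)
  case (Suc N)
  define H \<Lambda> where "H = (\<lambda>u. \<Sum>k=1..N. hs k u)" and "\<Lambda> = (\<Sum>k=1..N. Ls k)"
  define w where "w = cyclic_prox c hs N x"
  define v where "v = prox c (hs (Suc N)) w"
  have g: "geodesically_convex (hs (Suc N))" and lip: "(Ls (Suc N))-lipschitz_on UNIV (hs (Suc N))"
    using Suc.prems by auto
  have \<Lambda>: "\<Lambda>-lipschitz_on UNIV H"
    unfolding \<Lambda>_def H_def using Suc.prems by (intro lipschitz_on_sum) auto
  have IH: "(dist w y)\<^sup>2 \<le> (dist x y)\<^sup>2 + 2 * c * (H y - H w) + c\<^sup>2 * \<Lambda>\<^sup>2"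
    using Suc by (simp add: H_def \<Lambda>_def w_def)
  have step: "(dist v y)\<^sup>2 \<le> (dist w y)\<^sup>2 + 2 * c * (hs (Suc N) y - hs (Suc N) v)"
    using prox_variational_inequality[OF g lip c, of w y] unfolding v_def
    by (smt (verit) zero_le_power2)
  have "H v - H w \<le> \<Lambda> * dist w v"
    using lipschitz_onD[OF \<Lambda>, of v w] by (simp add: dist_real_def dist_commute)
  also have "\<dots> \<le> \<Lambda> * (c * Ls (Suc N))"
    unfolding v_def using dist_prox_le[OF g lip c] lipschitz_on_nonneg[OF \<Lambda>]
    by (intro mult_left_mono)
  finally have "2 * c * (H v - H w) \<le> 2 * c * (\<Lambda> * (c * Ls (Suc N)))"
    using c by (intro mult_left_mono) auto
  \<comment> \<open>The two sides differ by \<open>(c * Ls (Suc N))^2\<close>.\<close>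
  moreover have "c\<^sup>2 * \<Lambda>\<^sup>2 + 2 * c * (\<Lambda> * (c * Ls (Suc N))) \<le> c\<^sup>2 * (\<Lambda> + Ls (Suc N))\<^sup>2"
    using zero_le_power2[of "c * Ls (Suc N)"] by (simp add: power2_eq_square algebra_simps)
  ultimately have "(dist v y)\<^sup>2 \<le> (dist x y)\<^sup>2
      + 2 * c * ((H y + hs (Suc N) y) - (H v + hs (Suc N) v)) + c\<^sup>2 * (\<Lambda> + Ls (Suc N))\<^sup>2"
    using IH step by (simp add: algebra_simps)
  then show ?case
    by (simp add: cyclic_prox_Suc H_def \<Lambda>_def v_def w_def)
qed simp

section \<open>Comparison of two discrete schemes\<close>

text \<open>A discrete evolution variational inequality with a speed bound. Its error term leaves
  room for cyclic compositions, so that one comparison covers them and the resolvents of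
  \<open>h\<close>.\<close>

definition approx_evi :: "('a::metric_space \<Rightarrow> real) \<Rightarrow> real \<Rightarrow> real \<Rightarrow> (nat \<Rightarrow> 'a) \<Rightarrow> bool" where
  "approx_evi h L c X \<longleftrightarrow> (\<forall>i. dist (X i) (X (Suc i)) \<le> c * L) \<and>
    (\<forall>i y. (dist (X (Suc i)) y)\<^sup>2 \<le> (dist (X i) y)\<^sup>2 + 2 * c * (h y - h (X (Suc i))) + c\<^sup>2 * L\<^sup>2)"

lemma approx_evi_cyclic_prox:
  fixes hs :: "nat \<Rightarrow> 'a::hadamard_space \<Rightarrow> real"
  assumes "\<And>k. k \<in> {1..N} \<Longrightarrow> geodesically_convex (hs k)"
    and "\<And>k. k \<in> {1..N} \<Longrightarrow> (Ls k)-lipschitz_on UNIV (hs k)" and "0 \<le> c"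
  shows "approx_evi (\<lambda>y. \<Sum>k=1..N. hs k y) (\<Sum>k=1..N. Ls k) c (\<lambda>i. (cyclic_prox c hs N ^^ i) x)"
  unfolding approx_evi_def
  using dist_cyclic_prox_le[OF assms] cyclic_prox_variational_inequality[OF assms] by simp

lemma approx_evi_prox:
  fixes h :: "'a::hadamard_space \<Rightarrow> real"
  assumes "geodesically_convex h" "L-lipschitz_on UNIV h" "0 \<le> c"
  shows "approx_evi h L c (\<lambda>i. (prox c h ^^ i) x)"
  using approx_evi_cyclic_prox[of 1 "\<lambda>_. h" "\<lambda>_. L" c x] assms
  by (simp add: cyclic_prox_def)

lemma approx_evi_dist_start:
  assumes "approx_evi h L c X"
  shows "dist (X 0) (X i) \<le> real i * c * L"
proof (induction i)
  case (Suc i)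
  have "dist (X i) (X (Suc i)) \<le> c * L"
    using assms by (simp add: approx_evi_def)
  with Suc show ?case
    using dist_triangle[of "X 0" "X (Suc i)" "X i"] by (simp add: algebra_simps)
qed simp

text \<open>Doubling of variables: the bound is the squared gap between the times
  \<open>i * c\<close> and \<open>j * s\<close> plus a term for accumulated errors. When
  \<open>i\<close> or \<open>j\<close> is 0, one scheme is at rest and the speed bound
  suffices.\<close>

lemma approx_evi_doubling:
  assumes X: "approx_evi h L c X" and Z: "approx_evi h L s Z" and start: "X 0 = Z 0"
    and c: "0 < c" and s: "0 < s"
  shows "(dist (X i) (Z j))\<^sup>2
    \<le> L\<^sup>2 * ((real i * c - real j * s)\<^sup>2 + 2 * real i * c\<^sup>2 + 2 * real j * s\<^sup>2)"
proof (induction i arbitrary: j)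
  case 0
  have "(dist (X 0) (Z j))\<^sup>2 \<le> (real j * s * L)\<^sup>2"
    using approx_evi_dist_start[OF Z, of j] start by (intro power_mono) auto
  also have "\<dots> \<le> L\<^sup>2 * ((real j * s)\<^sup>2 + 2 * real j * s\<^sup>2)"
    by (simp add: power_mult_distrib algebra_simps)
  finally show ?case by simp
next
  case (Suc i)
  show ?case
  proof (induction j)
    case 0
    have "(dist (X (Suc i)) (Z 0))\<^sup>2 \<le> (real (Suc i) * c * L)\<^sup>2"
      using approx_evi_dist_start[OF X, of "Suc i"] start
      by (intro power_mono) (auto simp: dist_commute)
    also have "\<dots> \<le> L\<^sup>2 * ((real (Suc i) * c)\<^sup>2 + 2 * real (Suc i) * c\<^sup>2)"
      by (simp add: power_mult_distrib algebra_simps del: of_nat_Suc)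
    finally show ?case by simp
  next
    case IH: (Suc j)
    define B where "B = (\<lambda>a b :: real. L\<^sup>2 * ((a * c - b * s)\<^sup>2 + 2 * a * c\<^sup>2 + 2 * b * s\<^sup>2))"
    let ?D = "(dist (X (Suc i)) (Z (Suc j)))\<^sup>2"
    let ?h = "h (Z (Suc j)) - h (X (Suc i))"
    have D1: "?D \<le> B (real i) (real j + 1) + 2 * c * ?h + c\<^sup>2 * L\<^sup>2"
      using X[unfolded approx_evi_def, THEN conjunct2, rule_format, of i "Z (Suc j)"]
        Suc.IH[of "Suc j"] by (simp add: B_def add.commute)
    have D2: "?D \<le> B (real i + 1) (real j) - 2 * s * ?h + s\<^sup>2 * L\<^sup>2"
      using Z[unfolded approx_evi_def, THEN conjunct2, rule_format, of j "X (Suc i)"] IH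
      by (simp add: B_def add.commute dist_commute algebra_simps)
    \<comment> \<open>The weights \<open>s\<close> and \<open>c\<close> make the two multiples of
      \<open>?h\<close> opposite.\<close>
    have "(s + c) * ?D \<le> s * (B (real i) (real j + 1) + 2 * c * ?h + c\<^sup>2 * L\<^sup>2)
        + c * (B (real i + 1) (real j) - 2 * s * ?h + s\<^sup>2 * L\<^sup>2)"
      unfolding distrib_right using c s D1 D2 by (intro add_mono mult_left_mono) auto
    \<comment> \<open>\<open>B\<close> solves the recursion exactly. The terms linear in the time
      gap cancel; \<open>L^2 * (s * c^2 + c * s^2)\<close> arises once from the squared gaps and
      once from the errors, hence the factors 2 in \<open>B\<close>.\<close>
    also have "\<dots> = (s + c) * B (real i + 1) (real j + 1)"
      by (simp add: B_def power2_eq_square algebra_simps)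
    finally have "?D \<le> B (real i + 1) (real j + 1)"
      using c s by simp
    then show ?case by (simp add: B_def add.commute)
  qed
qed

text \<open>Both schemes have reached time \<open>t\<close>, so the time gap vanishes and only the
  error terms \<open>2 * t^2 / n\<close> and \<open>2 * t^2 / m\<close>, times \<open>L^2\<close>,
  remain.\<close>

lemma approx_evi_dist_le:
  assumes "approx_evi h L (t / real n) X" "approx_evi h L (t / real m) Z" "X 0 = Z 0"
    and t: "0 < t" and nm: "1 \<le> n" "1 \<le> m" and L: "0 \<le> L"
  shows "dist (X n) (Z m) \<le> L * t * sqrt (2 / real n + 2 / real m)"
proof -
  have "(dist (X n) (Z m))\<^sup>2 \<le> L\<^sup>2 * ((real n * (t / real n) - real m * (t / real m))\<^sup>2
      + 2 * real n * (t / real n)\<^sup>2 + 2 * real m * (t / real m)\<^sup>2)"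
    using t nm by (intro approx_evi_doubling[OF assms(1-3)]) auto
  also have "\<dots> = (L * t)\<^sup>2 * (2 / real n + 2 / real m)"
    using nm by (simp add: field_simps power2_eq_square)
  finally have "dist (X n) (Z m) \<le> sqrt ((L * t)\<^sup>2 * (2 / real n + 2 / real m))"
    by (rule real_le_rsqrt)
  then show ?thesis
    using t L by (simp only: real_sqrt_mult) simp
qed

section \<open>The gradient flow and the convergence rate\<close>

lemma gradient_flow_limit:
  fixes h :: "'a::hadamard_space \<Rightarrow> real"
  assumes h: "geodesically_convex h" and lip: "L-lipschitz_on UNIV h" and t: "0 < t"
  shows "(\<lambda>k. (prox (t / real k) h ^^ k) x) \<longlonglongrightarrow> gradient_flow h t x"
proof -
  let ?Z = "\<lambda>k. (prox (t / real k) h ^^ k) x"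
  have L: "0 \<le> L" using lip by (rule lipschitz_on_nonneg)
  have "Cauchy ?Z"
  proof (rule metric_CauchyI)
    fix e :: real assume e: "0 < e"
    have "(\<lambda>k. L * t * sqrt (2 * (1 / real k) + 2 * (1 / real k))) \<longlonglongrightarrow> L * t * sqrt (2 * 0 + 2 * 0)"
      by (intro tendsto_intros lim_1_over_n)
    then have "(\<lambda>k. L * t * sqrt (2 / real k + 2 / real k)) \<longlonglongrightarrow> 0"
      by simp
    then have "eventually (\<lambda>k. L * t * sqrt (2 / real k + 2 / real k) < e) sequentially"
      using e by (rule order_tendstoD(2))
    \<comment> \<open>Index 0 is excluded: there \<open>t / real 0\<close> is 0, whereas the
      comparison concerns positive steps.\<close>
    from eventually_conj[OF this eventually_ge_at_top[of 1]]
    obtain M where M: "L * t * sqrt (2 / real M + 2 / real M) < e" "1 \<le> M"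
      unfolding eventually_sequentially by blast
    have "dist (?Z i) (?Z j) < e" if "M \<le> i" "M \<le> j" for i j
    proof -
      have "dist (?Z i) (?Z j) \<le> L * t * sqrt (2 / real i + 2 / real j)"
        using that M(2) t L h lip
        by (intro approx_evi_dist_le[where h = h] approx_evi_prox) auto
      also have "\<dots> \<le> L * t * sqrt (2 / real M + 2 / real M)"
        using that M(2) L t
        by (intro mult_left_mono real_sqrt_le_mono add_mono divide_left_mono) auto
      finally show ?thesis using M(1) by simp
    qed
    then show "\<exists>M. \<forall>i\<ge>M. \<forall>j\<ge>M. dist (?Z i) (?Z j) < e" by blast
  qed
  then have "convergent ?Z" by (rule Cauchy_convergent)
  then show ?thesis
    using t by (simp add: gradient_flow_def convergent_LIMSEQ_iff)
qed

text \<open>The comparison with the \<open>m\<close>-step resolvent scheme holds for every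
  \<open>m \<ge> 1\<close>, and its contribution \<open>2 / m\<close> disappears in the
  limit.\<close>

lemma dist_gradient_flow_approx_evi_le:
  fixes h :: "'a::hadamard_space \<Rightarrow> real"
  assumes h: "geodesically_convex h" and lip: "L-lipschitz_on UNIV h" and t: "0 < t"
    and n: "1 \<le> n" and X: "approx_evi h L (t / real n) X"
  shows "dist (gradient_flow h t (X 0)) (X n) \<le> L * t * sqrt (2 / real n)"
proof -
  let ?Z = "\<lambda>k. (prox (t / real k) h ^^ k) (X 0)"
  have "(\<lambda>m. dist (?Z m) (X n)) \<longlonglongrightarrow> dist (gradient_flow h t (X 0)) (X n)"
    by (intro tendsto_intros gradient_flow_limit[OF h lip t])
  moreover have "(\<lambda>m. L * t * sqrt (2 * (1 / real m) + 2 / real n)) \<longlonglongrightarrow> L * t * sqrt (2 * 0 + 2 / real n)"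
    by (intro tendsto_intros lim_1_over_n)
  moreover have "\<forall>m\<ge>1. dist (?Z m) (X n) \<le> L * t * sqrt (2 * (1 / real m) + 2 / real n)"
  proof (intro allI impI)
    fix m :: nat assume "1 \<le> m"
    then have "dist (?Z m) (X n) \<le> L * t * sqrt (2 / real m + 2 / real n)"
      using h lip t n X lipschitz_on_nonneg[OF lip]
      by (intro approx_evi_dist_le[where h = h] approx_evi_prox) auto
    then show "dist (?Z m) (X n) \<le> L * t * sqrt (2 * (1 / real m) + 2 / real n)" by simp
  qed
  ultimately have "dist (gradient_flow h t (X 0)) (X n) \<le> L * t * sqrt (2 * 0 + 2 / real n)"
    by (blast intro: LIMSEQ_le)
  then show ?thesis by simp
qed

theorem lemma7p4:
  fixes h :: "'a::hadamard_space \<Rightarrow> real"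
    and hs :: "nat \<Rightarrow> 'a \<Rightarrow> real"
    and Ls :: "nat \<Rightarrow> real"
    and N n :: nat
    and t :: real
    and x :: 'a
  assumes "geodesically_convex h"
    and "\<And>y. h y = (\<Sum>k=1..N. hs k y)"
    and "\<And>k. k \<in> {1..N} \<Longrightarrow> geodesically_convex (hs k)"
    and "\<And>k. k \<in> {1..N} \<Longrightarrow> (Ls k)-lipschitz_on UNIV (hs k)"
    and "0 \<le> t"
    and "1 \<le> n"
  shows "dist (gradient_flow h t x) ((cyclic_prox (t / real n) hs N ^^ n) x)
    \<le> 8 * (\<Sum>k=1..N. Ls k) * t * real n powr (- 1 / 4)"
proof (cases "t = 0")
  case True
  \<comment> \<open>At time 0 flow and scheme both stay at \<open>x\<close>, so the distance is
    0.\<close>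
  have "(cyclic_prox 0 hs N ^^ n) x = x"
    by (induction n) simp_all
  with True show ?thesis by (simp add: gradient_flow_def)
next
  case False
  with \<open>0 \<le> t\<close> have t: "0 < t" by simp
  let ?L = "\<Sum>k=1..N. Ls k"
  have h: "h = (\<lambda>y. \<Sum>k=1..N. hs k y)"
    using assms(2) by blast
  have lip: "?L-lipschitz_on UNIV h"
    unfolding h using assms(4) by (rule lipschitz_on_sum)
  have "approx_evi h ?L (t / real n) (\<lambda>i. (cyclic_prox (t / real n) hs N ^^ i) x)"
    unfolding h using t by (intro approx_evi_cyclic_prox assms(3,4)) auto
  from dist_gradient_flow_approx_evi_le[OF assms(1) lip t \<open>1 \<le> n\<close> this]
  have "dist (gradient_flow h t x) ((cyclic_prox (t / real n) hs N ^^ n) x)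
      \<le> ?L * t * sqrt (2 / real n)"
    by simp
  \<comment> \<open>The proved rate is of order \<open>n powr (- 1 / 2)\<close>; for
    \<open>n \<ge> 1\<close> this is below \<open>n powr (- 1 / 4)\<close>, and
    \<open>sqrt 2 < 8\<close>.\<close>
  also have "\<dots> \<le> ?L * t * (8 * real n powr (- 1 / 4))"
  proof (intro mult_left_mono)
    have "sqrt (2 / real n) = sqrt 2 * real n powr (- 1 / 2)"
      using \<open>1 \<le> n\<close> by (simp add: real_sqrt_divide powr_minus powr_half_sqrt field_simps)
    also have "\<dots> \<le> 8 * real n powr (- 1 / 4)"
      using \<open>1 \<le> n\<close> sqrt2_less_2 by (intro mult_mono powr_mono) auto
    finally show "sqrt (2 / real n) \<le> 8 * real n powr (- 1 / 4)" .
  qed (use t lipschitz_on_nonneg[OF lip] in auto)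
  finally show ?thesis by (simp add: mult_ac)
qed

end
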